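(* Let $X$ be a topological space and let $\mathcal{I}$ be an ideal on $\omega$. Then: (i) $\mathcal{I}$-limits and $\mathcal{I}^\star$-limits of sequences in $X$ are unique, provided $X$ is Hausdorff; (ii) $\mathcal{I}^\star$-convergence implies $\mathcal{I}$-convergence (that is, if a sequence in $X$ is $\mathcal{I}^\star$-convergent to $\ell \in X$, then it is $\mathcal{I}$-convergent to $\ell$); (iii) $\mathcal{I}$-convergence implies $\mathcal{I}^\star$-convergence (that is, if a sequence in $X$ is $\mathcal{I}$-convergent to $\ell \in X$, then it is $\mathcal{I}^\star$-convergent to $\ell$), provided $X$ is first countable and $\mathcal{I}$ is a P-ideal; (iv) a sequence $(x_n) \in X^{\omega}$ is $\mathcal{I}$-convergent if and only if there exists an $\mathcal{I}$-convergent subsequence $(x_{n_k})$ such that $\{n_k : k \in \omega\} \in \mathcal{I}^\star$, provided $\mathcal{I}$ is a G-ideal.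
   Context: $\omega$ denotes the set of positive integers. An ideal $\mathcal{I}$ on $\omega$ is a family of subsets of $\omega$ closed under finite unions and under taking subsets of its elements, different from the power set of $\omega$ and containing all singletons. Its dual filter is $\mathcal{I}^\star := \{A \subseteq \omega : A^c \in \mathcal{I}\}$. A sequence $(x_n)$ in a topological space $X$ is $\mathcal{I}$-convergent to $\ell \in X$ (and $\ell$ is an $\mathcal{I}$-limit of it) if $\{n : x_n \in U\} \in \mathcal{I}^\star$ for all neighborhoods $U$ of $\ell$; it is $\mathcal{I}$-convergent if it is $\mathcal{I}$-convergent to some $\ell \in X$. A subsequence $(x_{n_k})$, with $(n_k)_{k\in\omega}$ strictly increasing, is regarded as the sequence $k \mapsto x_{n_k}$ indexed by $k \in \omega$; thus it is $\mathcal{I}$-convergent to $\ell$ if $\{k : x_{n_k} \in U\} \in \mathcal{I}^\star$ for all neighborhoods $U$ of $\ell$. A sequence $(x_n)$ in $X$ is $\mathcal{I}^\star$-convergent to $\ell \in X$ (and $\ell$ is an $\mathcal{I}^\star$-limit of it) if there exists a subsequence $(x_{n_k})$ which converges to $\ell$ in the ordinary sense and satisfies $\{n_k : k \in \omega\} \in \mathcal{I}^\star$. P-ideal: the ideal $\mathcal{I}$ is a P-ideal if for every sequence $(A_n)$ of sets in $\mathcal{I}$ there exists $A \in \mathcal{I}$ such that $A_n \setminus A$ is finite for all $n$. G-ideal: for infinite sets $A, B \subseteq \omega$, where $A$ has canonical (increasing) enumeration $\{a_n : n \in \omega\}$, put $A_B := \{a_b : b \in B\}$. The ideal $\mathcal{I}$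 is a G-ideal if for all infinite $A, B \subseteq \omega$ with $A \in \mathcal{I}^\star$ one has $A_B \in \mathcal{I}^\star$ if and only if $B \in \mathcal{I}^\star$. *)

theory Defs
  imports "HOL-Analysis.Analysis"
begin

text \<open>
  The index set \<open>\<omega>\<close> of positive integers is represented by the order-isomorphic type
  \<^typ>\<open>nat\<close>; increasing enumerations are accordingly indexed from \<open>0\<close>, both for
  subsequences and for \<^const>\<open>enumerate\<close>.
\<close>

text \<open>
  That \<open>{} \<in> I\<close> follows from the closure under subsets together with the last clause.
\<close>

definition ideal_on_nat :: "nat set set \<Rightarrow> bool" where
  "ideal_on_nat I \<longleftrightarrow>
     (\<forall>A\<in>I. \<forall>B\<in>I. A \<union> B \<in> I) \<and>
     (\<forall>A\<in>I. \<forall>B. B \<subseteq> A \<longrightarrow> B \<in> I) \<and>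
     I \<noteq> Pow UNIV \<and>
     (\<forall>n. {n} \<in> I)"

definition dual_filter :: "nat set set \<Rightarrow> nat set set" where
  "dual_filter I = {A. - A \<in> I}"

definition nbhd :: "'a topology \<Rightarrow> 'a \<Rightarrow> 'a set \<Rightarrow> bool" where
  "nbhd X l U \<longleftrightarrow> U \<subseteq> topspace X \<and> (\<exists>V. openin X V \<and> l \<in> V \<and> V \<subseteq> U)"

definition I_limit :: "'a topology \<Rightarrow> nat set set \<Rightarrow> (nat \<Rightarrow> 'a) \<Rightarrow> 'a \<Rightarrow> bool" where
  "I_limit X I x l \<longleftrightarrow>
     l \<in> topspace X \<and> (\<forall>U. nbhd X l U \<longrightarrow> {n. x n \<in> U} \<in> dual_filter I)"

definition I_convergent :: "'a topology \<Rightarrow> nat set set \<Rightarrow> (nat \<Rightarrow> 'a) \<Rightarrow> bool" where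
  "I_convergent X I x \<longleftrightarrow> (\<exists>l\<in>topspace X. I_limit X I x l)"

definition Istar_limit :: "'a topology \<Rightarrow> nat set set \<Rightarrow> (nat \<Rightarrow> 'a) \<Rightarrow> 'a \<Rightarrow> bool" where
  "Istar_limit X I x l \<longleftrightarrow>
     (\<exists>s :: nat \<Rightarrow> nat. strict_mono s \<and> limitin X (x \<circ> s) l sequentially \<and>
        range s \<in> dual_filter I)"

definition P_ideal :: "nat set set \<Rightarrow> bool" where
  "P_ideal I \<longleftrightarrow>
     ideal_on_nat I \<and>
     (\<forall>A :: nat \<Rightarrow> nat set. (\<forall>n. A n \<in> I) \<longrightarrow> (\<exists>B\<in>I. \<forall>n. finite (A n - B)))"

definition G_ideal :: "nat set set \<Rightarrow> bool" where
  "G_ideal I \<longleftrightarrow>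
     ideal_on_nat I \<and>
     (\<forall>A B. infinite A \<and> infinite B \<and> A \<in> dual_filter I \<longrightarrow>
        (enumerate A ` B \<in> dual_filter I \<longleftrightarrow> B \<in> dual_filter I))"

end

theory Submission
  imports Defs
begin

text \<open>
  The sets of the dual filter are closed under supersets, finite intersections and finite
  modifications, and none of them is finite; call them large. All four claims reduce to showing
  that certain index sets determined by neighbourhoods are large.

  A tail of a subsequence with large index set still has a large index set, so an
  \<open>I\<^sup>\<star>\<close>-limit is an \<open>I\<close>-limit (\<open>I_limit_if_Istar_limit\<close>). Two disjoint
  neighbourhoods would give two disjoint large sets, so in a Hausdorff space \<open>I\<close>-limits are unique
  (\<open>I_limit_unique\<close>), and with them \<open>I\<^sup>\<star>\<close>-limits.

  For the converse implication (\<open>Istar_limit_if_I_limit\<close>), a countable local base at the limit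
  yields countably many small sets of bad indices. A P-ideal contains one set that absorbs each
  of them up to finitely many indices; the enumeration of its complement is the subsequence sought.

  For the last claim, let \<open>A\<close> be the large index set of the subsequence. The positions \<open>k\<close> at which
  the subsequence lies in a given neighbourhood form a large set \<open>B\<close>, and the original sequence
  lies in that neighbourhood at the indices in \<open>A\<^sub>B\<close>. The G-ideal property makes \<open>A\<^sub>B\<close>
  large (\<open>I_limit_if_subseq_I_limit\<close>). In the other direction, the sequence is a subsequence of
  itself.
\<close>

lemma ideal_on_nat_finite:
  assumes I: "ideal_on_nat I" and "finite F"
  shows "F \<in> I"
  using \<open>finite F\<close>
proof induction
  case empty
  show ?case using I unfolding ideal_on_nat_def by (meson empty_subsetI)
next
  case (insert n F)
  then have "{n} \<union> F \<in> I" using I unfolding ideal_on_nat_def by blast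
  then show ?case by simp
qed

lemma dual_filter_superset:
  assumes "ideal_on_nat I" "A \<in> dual_filter I" "A \<subseteq> B"
  shows "B \<in> dual_filter I"
  using assms unfolding ideal_on_nat_def dual_filter_def by blast

lemma dual_filter_Int:
  assumes "ideal_on_nat I" "A \<in> dual_filter I" "B \<in> dual_filter I"
  shows "A \<inter> B \<in> dual_filter I"
  using assms unfolding ideal_on_nat_def dual_filter_def by (simp add: Compl_Int)

lemma dual_filter_cofinite:
  assumes "ideal_on_nat I" "finite (- A)"
  shows "A \<in> dual_filter I"
  using ideal_on_nat_finite[OF assms] by (simp add: dual_filter_def)

text \<open>
  A finite member would have its cofinite complement in the filter too, and their empty
  intersection would make the ideal improper. This excludes disjoint members and ensures that
  increasing enumerations of members exist.
\<close>
lemma dual_filter_infinite: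
  assumes I: "ideal_on_nat I" and A: "A \<in> dual_filter I"
  shows "infinite A"
proof
  assume "finite A"
  then have "- A \<in> dual_filter I" using I by (simp add: dual_filter_cofinite)
  then have "{} \<in> dual_filter I" using dual_filter_Int[OF I A] by fastforce
  then have "UNIV \<in> I" by (simp add: dual_filter_def)
  then have "I = Pow UNIV" using I unfolding ideal_on_nat_def by blast
  then show False using I unfolding ideal_on_nat_def by blast
qed

lemma I_limit_iff_openin:
  assumes "ideal_on_nat I"
  shows "I_limit X I x l \<longleftrightarrow>
    l \<in> topspace X \<and> (\<forall>U. openin X U \<longrightarrow> l \<in> U \<longrightarrow> {n. x n \<in> U} \<in> dual_filter I)"
proof -
  have "{n. x n \<in> U} \<in> dual_filter I"
    if "\<forall>V. openin X V \<longrightarrow> l \<in> V \<longrightarrow> {n. x n \<in> V} \<in> dual_filter I" and "nbhd X l U" for U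
  proof -
    obtain V where "openin X V" "l \<in> V" "V \<subseteq> U"
      using \<open>nbhd X l U\<close> unfolding nbhd_def by blast
    then have "{n. x n \<in> V} \<in> dual_filter I" "{n. x n \<in> V} \<subseteq> {n. x n \<in> U}"
      using that(1) by auto
    then show ?thesis by (rule dual_filter_superset[OF assms])
  qed
  moreover have "nbhd X l U" if "openin X U" "l \<in> U" for U
    using that openin_subset unfolding nbhd_def by blast
  ultimately show ?thesis unfolding I_limit_def by blast
qed

lemma I_limit_unique:
  assumes I: "ideal_on_nat I" and "Hausdorff_space X"
    and l: "I_limit X I x l" and l': "I_limit X I x l'"
  shows "l = l'"
proof (rule ccontr)
  assume "l \<noteq> l'"
  then obtain U V where "openin X U" "openin X V" "l \<in> U" "l' \<in> V" and "disjnt U V"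
    using assms unfolding Hausdorff_space_def I_limit_def by metis
  then have "{n. x n \<in> U} \<in> dual_filter I" "{n. x n \<in> V} \<in> dual_filter I"
    using l l' by (auto simp: I_limit_iff_openin[OF I])
  then have "{n. x n \<in> U} \<inter> {n. x n \<in> V} \<in> dual_filter I"
    by (rule dual_filter_Int[OF I])
  moreover have "{n. x n \<in> U} \<inter> {n. x n \<in> V} = {}"
    using \<open>disjnt U V\<close> unfolding disjnt_def by blast
  ultimately show False
    using dual_filter_infinite[OF I] by (metis finite.emptyI)
qed

text \<open>
  Only finitely many terms of the convergent subsequence lie outside a given neighbourhood, and
  removing finitely many indices from a member of the dual filter leaves a member.
\<close>
lemma I_limit_if_Istar_limit:
  assumes I: "ideal_on_nat I" and "Istar_limit X I x l"
  shows "I_limit X I x l"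
proof -
  obtain s where "strict_mono s" and lim: "limitin X (x \<circ> s) l sequentially"
    and s: "range s \<in> dual_filter I"
    using assms(2) by (auto simp: Istar_limit_def)
  have "{n. x n \<in> U} \<in> dual_filter I" if U: "openin X U" "l \<in> U" for U
  proof -
    obtain N where N: "\<And>k. k \<ge> N \<Longrightarrow> x (s k) \<in> U"
      using lim U unfolding limitin_sequentially by auto
    have "- s ` {..<N} \<in> dual_filter I"
      using I by (simp add: dual_filter_cofinite)
    then have "range s \<inter> - s ` {..<N} \<in> dual_filter I"
      by (rule dual_filter_Int[OF I s])
    moreover have "range s \<inter> - s ` {..<N} \<subseteq> {n. x n \<in> U}"
      using N not_le by blast
    ultimately show ?thesis by (rule dual_filter_superset[OF I])
  qed
  moreover have "l \<in> topspace X" using lim by (rule limitin_topspace)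
  ultimately show ?thesis by (simp add: I_limit_iff_openin[OF I])
qed

lemma first_countable_sequence_base:
  assumes "first_countable X" "l \<in> topspace X"
  obtains V :: "nat \<Rightarrow> 'a set" where "\<And>n. openin X (V n)" "\<And>n. l \<in> V n"
    "\<And>U. openin X U \<Longrightarrow> l \<in> U \<Longrightarrow> \<exists>n. V n \<subseteq> U"
proof -
  have "\<exists>\<B>. countable \<B> \<and> (\<forall>V\<in>\<B>. openin X V) \<and>
      (\<forall>U. openin X U \<and> l \<in> U \<longrightarrow> (\<exists>V\<in>\<B>. l \<in> V \<and> V \<subseteq> U))"
    using assms by (simp add: first_countable_def)
  then obtain \<B> where \<B>: "countable \<B>" "\<And>V. V \<in> \<B> \<Longrightarrow> openin X V"
    "\<And>U. openin X U \<Longrightarrow> l \<in> U \<Longrightarrow> \<exists>V\<in>\<B>. l \<in> V \<and> V \<subseteq> U"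
    by auto
  define \<C> where "\<C> = {V \<in> \<B>. l \<in> V}"
  have "\<C> \<noteq> {}"
    using \<B>(3)[OF openin_topspace assms(2)] by (auto simp: \<C>_def)
  moreover have "countable \<C>"
    using \<B>(1) by (simp add: \<C>_def)
  ultimately have range_\<C>: "range (from_nat_into \<C>) = \<C>"
    by (rule range_from_nat_into)
  show thesis
  proof
    fix n
    have "from_nat_into \<C> n \<in> \<C>"
      using range_\<C> by blast
    then show "openin X (from_nat_into \<C> n)" "l \<in> from_nat_into \<C> n"
      using \<B>(2) by (auto simp: \<C>_def)
  next
    fix U assume "openin X U" "l \<in> U"
    then obtain V where "V \<in> \<C>" "V \<subseteq> U"
      using \<B>(3) unfolding \<C>_def by blast
    then show "\<exists>n. from_nat_into \<C> n \<subseteq> U"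
      using range_\<C> by (metis imageE)
  qed
qed

text \<open>
  Every open neighbourhood of the limit contains some \<open>V n\<close>, and a subsequence that avoids \<open>B\<close> can
  meet the bad set \<open>A n\<close> of \<open>V n\<close> only inside the finite set \<open>A n - B\<close>; hence it converges to the
  limit in the ordinary sense.
\<close>
lemma Istar_limit_if_I_limit:
  assumes "first_countable X" and P: "P_ideal I"
    and lim: "I_limit X I x l"
  shows "Istar_limit X I x l"
proof -
  have I: "ideal_on_nat I" using P unfolding P_ideal_def by blast
  have l: "l \<in> topspace X" using lim unfolding I_limit_def by blast
  obtain V :: "nat \<Rightarrow> 'a set" where V: "\<And>n. openin X (V n)" "\<And>n. l \<in> V n"
    "\<And>U. openin X U \<Longrightarrow> l \<in> U \<Longrightarrow> \<exists>n. V n \<subseteq> U"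
    by (rule first_countable_sequence_base[OF assms(1) l]) blast
  define A where "A n = - {m. x m \<in> V n}" for n
  have "\<forall>n. A n \<in> I"
    using lim V by (simp add: I_limit_iff_openin[OF I] dual_filter_def A_def)
  then have "\<exists>B\<in>I. \<forall>n. finite (A n - B)"
    using P unfolding P_ideal_def by blast
  then obtain B where "B \<in> I" and B: "\<And>n. finite (A n - B)"
    by blast
  then have compl: "- B \<in> dual_filter I"
    by (simp add: dual_filter_def)
  have inf: "infinite (- B)"
    using dual_filter_infinite[OF I compl] .
  define s where "s = enumerate (- B)"
  have s: "strict_mono s" "range s = - B"
    using inf by (simp_all add: s_def strict_mono_enumerate range_enumerate)
  have "\<forall>\<^sub>F k in sequentially. (x \<circ> s) k \<in> U" if U: "openin X U" "l \<in> U" for U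
  proof -
    obtain n where n: "V n \<subseteq> U" using V(3)[OF U] by blast
    have "finite (s -` (A n - B))"
      using B s(1) by (intro finite_vimageI) (auto intro: strict_mono_imp_inj_on)
    moreover have "{k. x (s k) \<notin> U} \<subseteq> s -` (A n - B)"
      using n s(2) unfolding A_def by blast
    ultimately have "finite {k. x (s k) \<notin> U}"
      by (rule finite_subset[rotated])
    then show ?thesis
      by (simp add: cofinite_eq_sequentially[symmetric] eventually_cofinite)
  qed
  then have "limitin X (x \<circ> s) l sequentially"
    using l by (simp add: limitin_def)
  then show ?thesis
    unfolding Istar_limit_def using s compl by (intro exI[of _ s]) simp
qed

text \<open>
  This turns an increasing subsequence into the canonical enumeration of its index set, in terms of
  which the G-ideal property is stated.
\<close>
lemma enumerate_range_strict_mono: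
  fixes s :: "nat \<Rightarrow> nat"
  assumes "strict_mono s"
  shows "enumerate (range s) = s"
proof
  fix n
  have inf: "infinite (range s)"
    using assms by (simp add: range_inj_infinite strict_mono_imp_inj_on)
  show "enumerate (range s) n = s n"
  proof (induction n)
    case 0
    show ?case
      unfolding enumerate_0 using assms
      by (intro Least_equality) (auto simp: strict_mono_less_eq)
  next
    case (Suc n)
    have "(LEAST m. m \<in> range s \<and> s n < m) = s (Suc n)"
      using assms by (intro Least_equality) (auto simp: strict_mono_less strict_mono_less_eq)
    then show ?case
      using inf Suc by (simp add: enumerate_Suc'')
  qed
qed

text \<open>
  By the G-ideal property, positions \<open>B\<close> that are large within the
  subsequence are carried by \<open>s\<close> to a large set of indices of the original sequence.
\<close>
lemma I_limit_if_subseq_I_limit: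
  assumes G: "G_ideal I" and s: "strict_mono s" "range s \<in> dual_filter I"
    and lim: "I_limit X I (x \<circ> s) l"
  shows "I_limit X I x l"
proof -
  have I: "ideal_on_nat I" using G unfolding G_ideal_def by blast
  have "{n. x n \<in> U} \<in> dual_filter I" if U: "openin X U" "l \<in> U" for U
  proof -
    define B where "B = {k. x (s k) \<in> U}"
    have B: "B \<in> dual_filter I"
      using lim U by (simp add: I_limit_iff_openin[OF I] B_def)
    then have "enumerate (range s) ` B \<in> dual_filter I"
      using G s(2) dual_filter_infinite[OF I] unfolding G_ideal_def by metis
    then have "s ` B \<in> dual_filter I"
      by (simp only: enumerate_range_strict_mono[OF s(1)])
    then show ?thesis
      by (rule dual_filter_superset[OF I]) (auto simp: B_def)
  qed
  then show ?thesis
    using lim by (simp add: I_limit_iff_openin[OF I])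
qed

theorem theorem2p4:
  fixes X :: "'a topology" and I :: "nat set set"
  assumes "ideal_on_nat I"
  shows
    "(Hausdorff_space X \<longrightarrow>
       (\<forall>x l l'. range x \<subseteq> topspace X \<longrightarrow> I_limit X I x l \<longrightarrow> I_limit X I x l' \<longrightarrow> l = l') \<and>
       (\<forall>x l l'. range x \<subseteq> topspace X \<longrightarrow> Istar_limit X I x l \<longrightarrow> Istar_limit X I x l' \<longrightarrow> l = l')) \<and>
     (\<forall>x l. range x \<subseteq> topspace X \<longrightarrow> Istar_limit X I x l \<longrightarrow> I_limit X I x l) \<and>
     (first_countable X \<and> P_ideal I \<longrightarrow>
       (\<forall>x l. range x \<subseteq> topspace X \<longrightarrow> I_limit X I x l \<longrightarrow> Istar_limit X I x l)) \<and>
     (G_ideal I \<longrightarrow>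
       (\<forall>x. range x \<subseteq> topspace X \<longrightarrow>
         (I_convergent X I x \<longleftrightarrow>
          (\<exists>s :: nat \<Rightarrow> nat. strict_mono s \<and> I_convergent X I (x \<circ> s) \<and>
             range s \<in> dual_filter I))))"
proof (intro conjI impI allI)
  fix x l l'
  assume "Hausdorff_space X" "I_limit X I x l" "I_limit X I x l'"
  then show "l = l'" by (rule I_limit_unique[OF assms])
next
  fix x l l'
  assume "Hausdorff_space X" "Istar_limit X I x l" "Istar_limit X I x l'"
  then show "l = l'"
    by (intro I_limit_unique[OF assms] I_limit_if_Istar_limit[OF assms])
next
  fix x l
  assume "Istar_limit X I x l"
  then show "I_limit X I x l" by (rule I_limit_if_Istar_limit[OF assms])
next
  fix x l
  assume "first_countable X \<and> P_ideal I" "I_limit X I x l"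
  then show "Istar_limit X I x l" by (intro Istar_limit_if_I_limit) simp_all
next
  fix x
  assume G: "G_ideal I"
  show "I_convergent X I x \<longleftrightarrow>
    (\<exists>s :: nat \<Rightarrow> nat. strict_mono s \<and> I_convergent X I (x \<circ> s) \<and> range s \<in> dual_filter I)"
    (is "_ \<longleftrightarrow> ?subseq")
  proof
    assume "I_convergent X I x"
    moreover have "range (id :: nat \<Rightarrow> nat) \<in> dual_filter I"
      by (simp add: dual_filter_cofinite[OF assms])
    ultimately show ?subseq
      by (intro exI[of _ id]) (simp add: strict_mono_def)
  next
    assume ?subseq
    then obtain s l where s: "strict_mono s" "range s \<in> dual_filter I"
      and l: "l \<in> topspace X" "I_limit X I (x \<circ> s) l"
      unfolding I_convergent_def by blast
    show "I_convergent X I x"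
      unfolding I_convergent_def using l(1) I_limit_if_subseq_I_limit[OF G s l(2)] ..
  qed
qed

end
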